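(* Let $S$ be an intra-regular AG-groupoid with left identity and let $A=(\mu_A,\gamma_A)$ be an intuitionistic fuzzy set of $S$. Then the following conditions are equivalent: (i) $A$ is an intuitionistic fuzzy bi-ideal of $S$; (ii) $A$ is an intuitionistic fuzzy generalized bi-ideal of $S$.
   Context: An AG-groupoid is a non-empty set $S$ with a binary operation satisfying the left invertive law $(ab)c=(cb)a$ for all $a,b,c\in S$ (no associativity is assumed); $a^2$ denotes $aa$. A left identity is an element $e\in S$ with $ea=a$ for all $a\in S$. $S$ is intra-regular if for every $a\in S$ there are $x,y\in S$ with $a=(xa^2)y$. An intuitionistic fuzzy set (IFS) of $S$ is a pair $A=(\mu_A,\gamma_A)$ of functions $\mu_A,\gamma_A:S\to[0,1]$ with $0\le \mu_A(x)+\gamma_A(x)\le 1$ for all $x\in S$. An IFS $A$ is an intuitionistic fuzzy AG-subgroupoid if $\mu_A(xy)\ge\min\{\mu_A(x),\mu_A(y)\}$ and $\gamma_A(xy)\le\max\{\gamma_A(x),\gamma_A(y)\}$ for all $x,y\in S$. An IFS $A$ is an intuitionistic fuzzy generalized bi-ideal if $\mu_A((xa)y)\ge\min\{\mu_A(x),\mu_A(y)\}$ and $\gamma_A((xa)y)\le\max\{\gamma_A(x),\gamma_A(y)\}$ for all $x,a,y\in S$. An intuitionistic fuzzy bi-ideal is an intuitionistic fuzzy AG-subgroupoid satisfying these same two inequalities for all $x,a,y\in S$. *)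

theory Defs
  imports Complex_Main
begin

locale ag_groupoid =
  fixes S :: "'a set" and mult :: "'a \<Rightarrow> 'a \<Rightarrow> 'a" (infixl "\<cdot>" 70)
  assumes nonempty: "S \<noteq> {}"
    and closed: "\<lbrakk>a \<in> S; b \<in> S\<rbrakk> \<Longrightarrow> a \<cdot> b \<in> S"
    and left_invertive: "\<lbrakk>a \<in> S; b \<in> S; c \<in> S\<rbrakk> \<Longrightarrow> (a \<cdot> b) \<cdot> c = (c \<cdot> b) \<cdot> a"
begin

definition left_identity :: "'a \<Rightarrow> bool" where
  "left_identity e \<longleftrightarrow> e \<in> S \<and> (\<forall>a\<in>S. e \<cdot> a = a)"

definition intra_regular :: bool where
  "intra_regular \<longleftrightarrow> (\<forall>a\<in>S. \<exists>x\<in>S. \<exists>y\<in>S. a = (x \<cdot> (a \<cdot> a)) \<cdot> y)"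

text \<open>An intuitionistic fuzzy set is a pair of a membership and a non-membership function; only
  the values of the two functions on the carrier are constrained or used.\<close>

definition ifs :: "('a \<Rightarrow> real) \<times> ('a \<Rightarrow> real) \<Rightarrow> bool" where
  "ifs = (\<lambda>(\<mu>, \<gamma>). \<forall>x\<in>S. \<mu> x \<in> {0..1} \<and> \<gamma> x \<in> {0..1} \<and> 0 \<le> \<mu> x + \<gamma> x \<and> \<mu> x + \<gamma> x \<le> 1)"

definition if_ag_subgroupoid :: "('a \<Rightarrow> real) \<times> ('a \<Rightarrow> real) \<Rightarrow> bool" where
  "if_ag_subgroupoid = (\<lambda>(\<mu>, \<gamma>). ifs (\<mu>, \<gamma>) \<and>
     (\<forall>x\<in>S. \<forall>y\<in>S. \<mu> (x \<cdot> y) \<ge> min (\<mu> x) (\<mu> y) \<and> \<gamma> (x \<cdot> y) \<le> max (\<gamma> x) (\<gamma> y)))"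

definition if_generalized_bi_ideal :: "('a \<Rightarrow> real) \<times> ('a \<Rightarrow> real) \<Rightarrow> bool" where
  "if_generalized_bi_ideal = (\<lambda>(\<mu>, \<gamma>). ifs (\<mu>, \<gamma>) \<and>
     (\<forall>x\<in>S. \<forall>a\<in>S. \<forall>y\<in>S. \<mu> ((x \<cdot> a) \<cdot> y) \<ge> min (\<mu> x) (\<mu> y) \<and>
                            \<gamma> ((x \<cdot> a) \<cdot> y) \<le> max (\<gamma> x) (\<gamma> y)))"

definition if_bi_ideal :: "('a \<Rightarrow> real) \<times> ('a \<Rightarrow> real) \<Rightarrow> bool" where
  "if_bi_ideal = (\<lambda>(\<mu>, \<gamma>). if_ag_subgroupoid (\<mu>, \<gamma>) \<and>
     (\<forall>x\<in>S. \<forall>a\<in>S. \<forall>y\<in>S. \<mu> ((x \<cdot> a) \<cdot> y) \<ge> min (\<mu> x) (\<mu> y) \<and>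
                            \<gamma> ((x \<cdot> a) \<cdot> y) \<le> max (\<gamma> x) (\<gamma> y)))"

end

end

(* With a left identity the medial law yields a(bc) = b(ac) and (ab)(cd) = (dc)(ba). These rewrite
   a = (x(aa))y into a = ac with c in S, so ab = (ac)b, and the generalized bi-ideal inequalities
   at (ac)b are exactly the AG-subgroupoid inequalities at ab. *)
theory Submission
  imports Defs
begin

context ag_groupoid
begin

text \<open>Three uses of the left invertive law: on the whole product, inside its left factor, and
  on the whole again.\<close>

lemma medial:
  assumes "a \<in> S" "b \<in> S" "c \<in> S" "d \<in> S"
  shows "(a \<cdot> b) \<cdot> (c \<cdot> d) = (a \<cdot> c) \<cdot> (b \<cdot> d)"
proof -
  have "(a \<cdot> b) \<cdot> (c \<cdot> d) = ((c \<cdot> d) \<cdot> b) \<cdot> a"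
    using assms by (intro left_invertive closed)
  also have "\<dots> = ((b \<cdot> d) \<cdot> c) \<cdot> a"
    using assms left_invertive[of c d b] by simp
  also have "\<dots> = (a \<cdot> c) \<cdot> (b \<cdot> d)"
    using assms by (intro left_invertive closed)
  finally show ?thesis .
qed

text \<open>This is the medial law for \<open>(e \<cdot> a) \<cdot> (b \<cdot> c)\<close>, with
  \<open>e\<close> absorbed on both sides.\<close>

lemma left_commute:
  assumes "left_identity e" "a \<in> S" "b \<in> S" "c \<in> S"
  shows "a \<cdot> (b \<cdot> c) = b \<cdot> (a \<cdot> c)"
  using assms medial[of e a b c] by (simp add: left_identity_def closed)

text \<open>Pulling \<open>c\<close> to the front leaves \<open>(a \<cdot> b) \<cdot> d\<close>,
  where the left invertive law swaps \<open>a\<close> and \<open>d\<close>; then \<open>c\<close> is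
  moved back in and the medial law sorts the middle factors.\<close>

lemma paramedial:
  assumes "left_identity e" "a \<in> S" "b \<in> S" "c \<in> S" "d \<in> S"
  shows "(a \<cdot> b) \<cdot> (c \<cdot> d) = (d \<cdot> c) \<cdot> (b \<cdot> a)"
proof -
  have "(a \<cdot> b) \<cdot> (c \<cdot> d) = c \<cdot> ((a \<cdot> b) \<cdot> d)"
    using assms by (intro left_commute closed)
  also have "\<dots> = c \<cdot> ((d \<cdot> b) \<cdot> a)"
    using assms left_invertive[of a b d] by simp
  also have "\<dots> = (d \<cdot> b) \<cdot> (c \<cdot> a)"
    using assms by (intro left_commute closed)
  also have "\<dots> = (d \<cdot> c) \<cdot> (b \<cdot> a)"
    using assms by (intro medial)
  finally show ?thesis .
qed

lemma intra_regular_right_factor: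
  assumes e: "left_identity e" and "intra_regular" and a: "a \<in> S"
  obtains c where "c \<in> S" "a = a \<cdot> c"
proof -
  obtain x y where x: "x \<in> S" and y: "y \<in> S" and axy: "a = (x \<cdot> (a \<cdot> a)) \<cdot> y"
    using assms unfolding intra_regular_def by blast
  have eS: "e \<in> S" and id: "\<And>b. b \<in> S \<Longrightarrow> e \<cdot> b = b"
    using e by (auto simp: left_identity_def)
  \<comment> \<open>\<open>z\<close> is what \<open>x\<close> and \<open>y\<close> merge into once
    \<open>a \<cdot> a\<close> has been moved to the left of both.\<close>
  define z where "z = (y \<cdot> e) \<cdot> x"
  have z: "z \<in> S"
    unfolding z_def using x y eS by (intro closed)
  \<comment> \<open>Inserting \<open>e\<close> before \<open>y\<close> creates the four factors that
    \<open>paramedial\<close> needs.\<close>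
  have "(x \<cdot> (a \<cdot> a)) \<cdot> y = (x \<cdot> (a \<cdot> a)) \<cdot> (e \<cdot> y)"
    using y id by simp
  also have "\<dots> = (y \<cdot> e) \<cdot> ((a \<cdot> a) \<cdot> x)"
    using e a x y eS by (intro paramedial closed)
  also have "\<dots> = (a \<cdot> a) \<cdot> z"
    unfolding z_def using e a x y eS by (intro left_commute closed)
  \<comment> \<open>The same insertion before \<open>z\<close> lets \<open>paramedial\<close> carry
    \<open>a \<cdot> a\<close> to the right, where \<open>left_commute\<close> can extract one copy
    of \<open>a\<close>; the other copy stays inside the factor \<open>c\<close>.\<close>
  also have "\<dots> = (a \<cdot> a) \<cdot> (e \<cdot> z)"
    using z id by simp
  also have "\<dots> = (z \<cdot> e) \<cdot> (a \<cdot> a)"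
    using e a z eS by (intro paramedial)
  also have "\<dots> = a \<cdot> ((z \<cdot> e) \<cdot> a)"
    using e a z eS by (intro left_commute closed)
  finally have "a = a \<cdot> ((z \<cdot> e) \<cdot> a)"
    using axy by simp
  moreover have "(z \<cdot> e) \<cdot> a \<in> S"
    using a z eS by (intro closed)
  ultimately show ?thesis
    using that by blast
qed

lemma if_generalized_bi_ideal_imp_subgroupoid:
  assumes "left_identity e" and "intra_regular" and gen: "if_generalized_bi_ideal (\<mu>, \<gamma>)"
  shows "if_ag_subgroupoid (\<mu>, \<gamma>)"
proof -
  have "\<mu> (x \<cdot> y) \<ge> min (\<mu> x) (\<mu> y) \<and> \<gamma> (x \<cdot> y) \<le> max (\<gamma> x) (\<gamma> y)"
    if x: "x \<in> S" and y: "y \<in> S" for x y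
  proof -
    obtain c where "c \<in> S" and xc: "x = x \<cdot> c"
      using intra_regular_right_factor assms(1,2) x by blast
    \<comment> \<open>The bounds do not involve the middle factor, so the values of \<mu> and
      \<gamma> at \<open>c\<close> are irrelevant.\<close>
    from gen have "\<mu> ((x \<cdot> c) \<cdot> y) \<ge> min (\<mu> x) (\<mu> y) \<and> \<gamma> ((x \<cdot> c) \<cdot> y) \<le> max (\<gamma> x) (\<gamma> y)"
      using x \<open>c \<in> S\<close> y unfolding if_generalized_bi_ideal_def by blast
    then show ?thesis
      \<comment> \<open>The equation folds \<open>x \<cdot> c\<close> back to \<open>x\<close>; read
        from left to right it would rewrite \<open>x\<close> forever.\<close>
      by (simp flip: xc)
  qed
  then show ?thesis
    using gen by (simp add: if_generalized_bi_ideal_def if_ag_subgroupoid_def)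
qed

end

theorem theorem15:
  fixes S :: "'a set" and mult :: "'a \<Rightarrow> 'a \<Rightarrow> 'a"
    and A :: "('a \<Rightarrow> real) \<times> ('a \<Rightarrow> real)"
  assumes "ag_groupoid S mult"
    and "\<exists>e. ag_groupoid.left_identity S mult e"
    and "ag_groupoid.intra_regular S mult"
    and "ag_groupoid.ifs S A"
  shows "ag_groupoid.if_bi_ideal S mult A \<longleftrightarrow> ag_groupoid.if_generalized_bi_ideal S mult A"
proof -
  interpret ag_groupoid S mult by fact
  obtain e where e: "left_identity e"
    using assms(2) by blast
  obtain \<mu> \<gamma> where A: "A = (\<mu>, \<gamma>)"
    by (cases A)
  show ?thesis
  proof
    assume "if_bi_ideal A"
    \<comment> \<open>The inequalities are shared by both definitions; \<open>assms(4)\<close>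
      supplies \<open>ifs\<close>, which the bi-ideal contains only inside the folded
      \<open>if_ag_subgroupoid\<close>.\<close>
    then show "if_generalized_bi_ideal A"
      using assms(4) by (simp add: A if_bi_ideal_def if_generalized_bi_ideal_def)
  next
    assume gen: "if_generalized_bi_ideal A"
    then have "if_ag_subgroupoid A"
      using if_generalized_bi_ideal_imp_subgroupoid e assms(3) by (simp add: A)
    then show "if_bi_ideal A"
      using gen by (simp add: A if_bi_ideal_def if_generalized_bi_ideal_def)
  qed
qed

end
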